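(* Let $f:[0,+\infty[\to[0,+\infty[$ and $\alpha:[0,1]\to\,]0,+\infty[$ be two continuous functions, with $f(0)=0$, and for each $\xi\ge 0$ set $F(\xi)=\int_0^{\xi}f(t)\,dt$. Assume that, for some $a>0$, the function $\xi\mapsto \frac{F(\xi)}{\xi^2}$ is non-increasing in $]0,a]$. Then the following assertions are equivalent: (i) for each $b>0$, the function $\xi\mapsto\frac{F(\xi)}{\xi^2}$ is not constant in $]0,b]$; (ii) for each $r>0$, there exists an open interval $I\subseteq\,]0,+\infty[$ such that, for every $\lambda\in I$, the problem $$\begin{cases}-u''=\lambda\,\alpha(t)f(u) & \text{in } [0,1]\\ u>0 & \text{in } ]0,1[\\ u(0)=u(1)=0\end{cases}$$ has a solution $u$ satisfying $$\int_0^1|u'(t)|^2\,dt<r.$$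
   Context: Notation: $]p,q[$ denotes the open interval with endpoints $p,q$, and $]p,q]$ the half-open interval excluding $p$ and including $q$. "Open interval" means a non-empty open interval. A solution of the boundary value problem is a function $u\in C^2([0,1])$ with $-u''(t)=\lambda\alpha(t)f(u(t))$ for all $t\in[0,1]$, $u(t)>0$ for all $t\in\,]0,1[$, and $u(0)=u(1)=0$. *)

theory Defs
  imports "HOL-Analysis.Analysis"
begin

(* Functions on [0,1] are represented by total functions real => real. Derivatives are
   taken within {0..1}, hence one-sided at the endpoints, and do not depend on the values
   outside {0..1}. *)
definition deriv01 :: "(real \<Rightarrow> real) \<Rightarrow> real \<Rightarrow> real" where
  "deriv01 u t = vector_derivative u (at t within {0..1})"

definition C2_01 :: "(real \<Rightarrow> real) \<Rightarrow> bool" where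
  "C2_01 u \<longleftrightarrow>
     u differentiable_on {0..1} \<and>
     deriv01 u differentiable_on {0..1} \<and>
     continuous_on {0..1} (deriv01 (deriv01 u))"

definition bvp_solution ::
  "(real \<Rightarrow> real) \<Rightarrow> (real \<Rightarrow> real) \<Rightarrow> real \<Rightarrow> (real \<Rightarrow> real) \<Rightarrow> bool" where
  "bvp_solution \<alpha> f lam u \<longleftrightarrow>
     C2_01 u \<and>
     (\<forall>t\<in>{0..1}. - deriv01 (deriv01 u) t = lam * \<alpha> t * f (u t)) \<and>
     (\<forall>t\<in>{0<..<1}. u t > 0) \<and>
     u 0 = 0 \<and> u 1 = 0"

definition primitive :: "(real \<Rightarrow> real) \<Rightarrow> real \<Rightarrow> real" where
  "primitive f \<xi> = integral {0..\<xi>} f"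

(* Non-empty; unbounded intervals are included. *)
definition open_interval :: "real set \<Rightarrow> bool" where
  "open_interval I \<longleftrightarrow> is_interval I \<and> open I \<and> I \<noteq> {}"

end

theory Submission
  imports Defs "HOL-Complex_Analysis.Great_Picard"
begin

text \<open>
Write \<open>F\<close> for \<open>primitive f\<close>. The solutions are critical points of the action
\<open>1/2 \<integral> u'\<^sup>2 - lam J(u)\<close> with potential \<open>J(u) = \<integral> \<alpha> F(u)\<close>. A small energy \<open>\<integral> u'\<^sup>2\<close> makes \<open>u\<close> uniformly
small (\<open>abs_primitive_le_energy\<close>), so only the behaviour of \<open>F\<close> near zero matters.

Suppose that \<open>F(\<xi>)/\<xi>\<^sup>2\<close> is constant near zero. Then \<open>f\<close> is linear there and solutions of small energy
solve a linear problem. Positive solutions of a linear problem belong to a single eigenvalue, by a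
Wronskian argument (\<open>linear_solutions_same_parameter\<close>), so no open interval of parameters is possible.

Suppose that \<open>F(\<xi>)/\<xi>\<^sup>2\<close> is not constant near zero. Since it is non-increasing, shrinking a small
function of positive potential by a suitable factor strictly increases its quotient of potential by energy
(\<open>potential_scale_strict\<close>). Let \<open>u\<^sub>1\<close> maximize
\<open>J\<close> on the sphere \<open>\<integral> u'\<^sup>2 = s\<^sup>2\<close>. The inequality between the quotients of \<open>u\<^sub>1\<close> and of a shrunk copy
opens an interval of parameters for which the action is positive on the sphere but negative somewhere in
the ball. A minimizer over the ball then lies in the interior and is not zero.

Both extrema must exist and the interior minimizer must solve the equation. For this the problem is
restricted to functions with \<open>u''\<close> bounded by a constant \<open>M\<close>, in the weak sense that \<open>u'\<close> is
\<open>M\<close>-Lipschitz; this set is compact by the theorem of Arzela and Ascoli (\<open>slopes_compact\<close>). The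
restriction is harmless if \<open>M\<close> bounds \<open>lam \<alpha> f\<close> on the relevant range: the solution \<open>v\<close> of the linear
problem \<open>- v'' = lam \<alpha> f(u)\<close>, with \<open>u\<close> the minimizer, is then admissible, and the derivative of the action
at \<open>u\<close> in the direction \<open>v - u\<close> equals \<open>- \<integral> (v' - u')\<^sup>2\<close>
(\<open>action_derivative_towards_response\<close>). A minimizer does not admit a direction of descent, so \<open>v = u\<close>.
\<close>

section \<open>Primitives and integrals on the unit interval\<close>

lemma primitive_has_derivative_within:
  assumes "continuous_on {0..1} p" "t \<in> {0..1}"
  shows "(primitive p has_real_derivative p t) (at t within {0..1})"
proof -
  have "primitive p = (\<lambda>t. integral {0..t} p)" by (rule ext) (simp add: primitive_def)
  then show ?thesis using integral_has_real_derivative[OF assms] by simp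
qed

lemma primitive_continuous_on:
  "continuous_on {0..1} p \<Longrightarrow> continuous_on {0..1} (primitive p)"
  by (rule DERIV_continuous_on) (rule primitive_has_derivative_within)

lemma primitive_at_0 [simp]: "primitive p 0 = 0"
  by (simp add: primitive_def)

lemma primitive_nonpos: "x \<le> 0 \<Longrightarrow> primitive p x = 0"
  by (cases "x = 0") (auto simp: primitive_def)

lemma primitive_linear_combination:
  fixes p q :: "real \<Rightarrow> real"
  assumes "continuous_on {0..1} p" "continuous_on {0..1} q" "t \<in> {0..1}"
  shows "primitive (\<lambda>s. c * p s + d * q s) t = c * primitive p t + d * primitive q t"
proof -
  have "continuous_on {0..t} p" "continuous_on {0..t} q"
    using assms by (auto elim: continuous_on_subset)
  then show ?thesis
    unfolding primitive_def
    by (subst integral_add) (auto intro!: integrable_continuous_interval continuous_intros)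
qed

lemma integral_pos_of_continuous_nonneg:
  fixes g :: "real \<Rightarrow> real"
  assumes "continuous_on {0..1} g" "\<And>t. t \<in> {0..1} \<Longrightarrow> g t \<ge> 0" "t0 \<in> {0..1}" "g t0 > 0"
  shows "integral {0..1} g > 0"
proof -
  have "integral {0..1} g \<ge> 0"
    using assms by (intro integral_nonneg integrable_continuous_interval) auto
  moreover have "integral {0..1} g \<noteq> 0"
    using integral_cbox_eq_0_iff[of 0 1 g] assms by auto
  ultimately show ?thesis by simp
qed

text \<open>
The one-dimensional Sobolev inequality: a small energy forces the function to be uniformly small, so
only the behaviour of the nonlinearity near zero matters for solutions of small energy.
\<close>

lemma abs_primitive_le_energy:
  fixes p :: "real \<Rightarrow> real"
  assumes p: "continuous_on {0..1} p" and le: "integral {0..1} (\<lambda>t. (p t)\<^sup>2) \<le> s\<^sup>2"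
    and s: "s > 0" and t: "t \<in> {0..1}"
  shows "\<bar>primitive p t\<bar> \<le> s"
proof -
  have int: "(\<lambda>t. ((p t)\<^sup>2 / s + s) / 2) integrable_on {0..1}"
    using p s by (intro integrable_continuous_interval continuous_intros) auto
  have pt: "p integrable_on {0..t}"
    using p t by (auto intro!: integrable_continuous_interval elim: continuous_on_subset)
  \<comment> \<open>the arithmetic-geometric mean inequality replaces Cauchy-Schwarz\<close>
  have amgm: "\<bar>p x\<bar> \<le> ((p x)\<^sup>2 / s + s) / 2" for x
  proof -
    have "0 \<le> (\<bar>p x\<bar> - s)\<^sup>2" by simp
    then have "2 * s * \<bar>p x\<bar> \<le> (p x)\<^sup>2 + s\<^sup>2" by (simp add: power2_diff algebra_simps)
    then show ?thesis using s by (simp add: field_simps power2_eq_square)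
  qed
  have "\<bar>primitive p t\<bar> \<le> integral {0..t} (\<lambda>x. ((p x)\<^sup>2 / s + s) / 2)"
    unfolding primitive_def real_norm_def[symmetric]
    using amgm t integrable_on_subinterval[OF int, of 0 t] pt
    by (intro integral_norm_bound_integral) auto
  also have "\<dots> \<le> integral {0..1} (\<lambda>x. ((p x)\<^sup>2 / s + s) / 2)"
    using s t integrable_on_subinterval[OF int, of 0 t] int
    by (intro integral_subset_le) auto
  also have "\<dots> = (integral {0..1} (\<lambda>t. (p t)\<^sup>2) / s + s) / 2"
  proof -
    have "(\<lambda>t. (p t)\<^sup>2 / s) integrable_on {0..1}"
      using p s by (intro integrable_continuous_interval continuous_intros) auto
    then have "integral {0..1} (\<lambda>x. (p x)\<^sup>2 / s + s) = integral {0..1} (\<lambda>x. (p x)\<^sup>2 / s) + s"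
      by (subst integral_add) auto
    then show ?thesis by simp
  qed
  also have "\<dots> \<le> s" using le s by (simp add: field_simps power2_eq_square)
  finally show ?thesis .
qed

section \<open>A compact set of slopes\<close>

text \<open>
The variational problem is posed for the derivative \<open>p = u'\<close> instead of \<open>u\<close> itself: then
\<open>u = primitive p\<close>, the boundary condition \<open>u 1 = 0\<close> says that \<open>p\<close> has mean zero, and nothing
has to be differentiated before regularity is known. The bound \<open>M\<close> on the Lipschitz constant,
that is, on the curvature of \<open>u\<close>, makes the set compact; it is chosen later so large that it does
not interfere with criticality.
\<close>

definition slopes :: "real \<Rightarrow> (real \<Rightarrow> real) set" where
  "slopes M = {p. M-lipschitz_on {0..1} p \<and> primitive p 1 = 0}"

lemma slopes_continuous_on: "p \<in> slopes M \<Longrightarrow> continuous_on {0..1} p"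
  by (auto simp: slopes_def intro: lipschitz_on_continuous_on)

lemma slopes_mono: "p \<in> slopes M \<Longrightarrow> M \<le> N \<Longrightarrow> p \<in> slopes N"
  by (auto simp: slopes_def intro: lipschitz_on_le)

text \<open>
A function of mean zero is the average of its own increments \<open>p t - p s\<close>, so the Lipschitz
constant also bounds its values.
\<close>

lemma slopes_bound:
  assumes p: "p \<in> slopes M" and t: "t \<in> {0..1}"
  shows "\<bar>p t\<bar> \<le> M"
proof -
  have pi: "p integrable_on {0..1}"
    using slopes_continuous_on[OF p] by (rule integrable_continuous_interval)
  have L: "M-lipschitz_on {0..1} p" and z: "integral {0..1} p = 0"
    using p by (auto simp: slopes_def primitive_def)
  have d: "\<bar>p t - p s\<bar> \<le> M" if s: "s \<in> {0..1}" for s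
  proof -
    have "\<bar>p t - p s\<bar> \<le> M * \<bar>t - s\<bar>"
      using lipschitz_onD[OF L t s] by (simp add: dist_real_def)
    also have "\<dots> \<le> M * 1"
      using lipschitz_on_nonneg[OF L] s t by (intro mult_left_mono) auto
    finally show ?thesis by simp
  qed
  have "p t = integral {0..1} (\<lambda>s. p t - p s)"
    using pi by (subst integral_diff) (auto simp: z)
  also have "\<bar>\<dots>\<bar> \<le> integral {0..1} (\<lambda>s::real. M)"
    unfolding real_norm_def[symmetric]
    by (rule integral_norm_bound_integral) (use pi d in \<open>auto intro: integrable_diff\<close>)
  finally show ?thesis by simp
qed

lemma slopes_scale:
  assumes "p \<in> slopes M" "0 \<le> s" "s \<le> 1"
  shows "(\<lambda>t. s * p t) \<in> slopes M"
proof -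
  have L: "M-lipschitz_on {0..1} p" and z: "primitive p 1 = 0"
    using assms by (auto simp: slopes_def)
  have "(s * M)-lipschitz_on {0..1} (\<lambda>t. s * p t)"
    using lipschitz_on_cmult_real[OF L, of s] assms by simp
  then have "M-lipschitz_on {0..1} (\<lambda>t. s * p t)"
    by (rule lipschitz_on_le) (use assms lipschitz_on_nonneg[OF L] in \<open>simp add: mult_left_le_one_le\<close>)
  then show ?thesis using z by (simp add: slopes_def primitive_def)
qed

lemma slopes_convex_combination:
  assumes p: "p \<in> slopes M" and q: "q \<in> slopes M" and "0 \<le> s" "s \<le> 1"
  shows "(\<lambda>t. (1 - s) * p t + s * q t) \<in> slopes M"
proof -
  have L: "M-lipschitz_on {0..1} p" "M-lipschitz_on {0..1} q"
    using p q by (auto simp: slopes_def)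
  have "((1 - s) * M + s * M)-lipschitz_on {0..1} (\<lambda>t. (1 - s) * p t + s * q t)"
    using lipschitz_on_cmult_real[OF L(1), of "1 - s"] lipschitz_on_cmult_real[OF L(2), of s] assms
    by (intro lipschitz_on_add) auto
  then have "M-lipschitz_on {0..1} (\<lambda>t. (1 - s) * p t + s * q t)"
    by (simp add: algebra_simps)
  then show ?thesis
    using p q slopes_continuous_on[OF p] slopes_continuous_on[OF q]
    by (simp add: slopes_def primitive_linear_combination)
qed

lemma slopes_pointwise_limit:
  assumes P: "\<And>n. P n \<in> slopes M" and lim: "\<And>t. t \<in> {0..1} \<Longrightarrow> (\<lambda>n. P n t) \<longlonglongrightarrow> p t"
  shows "p \<in> slopes M"
proof -
  have L: "M-lipschitz_on {0..1} (P n)" for n using P by (auto simp: slopes_def)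
  have lip: "M-lipschitz_on {0..1} p"
  proof (rule lipschitz_onI)
    fix x y :: real assume xy: "x \<in> {0..1}" "y \<in> {0..1}"
    have "(\<lambda>n. dist (P n x) (P n y)) \<longlonglongrightarrow> dist (p x) (p y)"
      using lim xy by (intro tendsto_intros) auto
    then show "dist (p x) (p y) \<le> M * dist x y"
      by (rule Lim_bounded) (use lipschitz_onD[OF L] xy in auto)
  qed (use lipschitz_on_nonneg[OF L] in auto)
  have "(\<lambda>n. integral {0..1} (P n)) \<longlonglongrightarrow> integral {0..1} p"
    using slopes_bound[OF P] slopes_continuous_on[OF P] lim
    by (intro dominated_convergence(2)[where h = "\<lambda>_. M"])
       (auto intro: integrable_continuous_interval)
  moreover have "integral {0..1} (P n) = 0" for n using P by (auto simp: slopes_def primitive_def)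
  ultimately have "integral {0..1} p = 0" by (simp add: LIMSEQ_const_iff)
  with lip show ?thesis by (simp add: slopes_def primitive_def)
qed

lemma slopes_compact:
  assumes P: "\<And>n :: nat. P n \<in> slopes M"
  obtains p k where "p \<in> slopes M" "strict_mono (k :: nat \<Rightarrow> nat)"
    "\<And>t. t \<in> {0..1} \<Longrightarrow> (\<lambda>n. P (k n) t) \<longlonglongrightarrow> p t"
proof -
  have M: "0 \<le> M" using P[of 0] lipschitz_on_nonneg by (auto simp: slopes_def)
  have L: "\<bar>P n x - P n y\<bar> \<le> M * \<bar>x - y\<bar>" if "x \<in> {0..1}" "y \<in> {0..1}" for n x y
  proof -
    have "M-lipschitz_on {0..1} (P n)" using P by (auto simp: slopes_def)
    from lipschitz_onD[OF this that] show ?thesis by (simp add: dist_real_def)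
  qed
  obtain p k where k: "strict_mono (k :: nat \<Rightarrow> nat)" and
    conv: "\<And>e. 0 < e \<Longrightarrow> \<exists>N. \<forall>n x. n \<ge> N \<and> x \<in> {0..1} \<longrightarrow> norm (P (k n) x - p x) < e"
  proof (rule Arzela_Ascoli[of "{0..1::real}" P M])
    fix x e :: real assume x: "x \<in> {0..1}" and e: "0 < e"
    show "\<exists>d>0. \<forall>n y. y \<in> {0..1} \<and> norm (x - y) < d \<longrightarrow> norm (P n x - P n y) < e"
    proof (intro exI[of _ "e / (M + 1)"] conjI allI impI)
      fix n y assume y: "y \<in> {0..1} \<and> norm (x - y) < e / (M + 1)"
      have "\<bar>P n x - P n y\<bar> \<le> M * \<bar>x - y\<bar>" using L x y by blast
      also have "\<dots> \<le> (M + 1) * \<bar>x - y\<bar>" by (simp add: distrib_right)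
      also have "\<dots> < e" using y M by (simp add: field_simps)
      finally show "norm (P n x - P n y) < e" by simp
    qed (use e M in auto)
  qed (use slopes_bound[OF P] in auto)
  have lim: "(\<lambda>n. P (k n) t) \<longlonglongrightarrow> p t" if "t \<in> {0..1}" for t
    unfolding LIMSEQ_iff using conv that by meson
  show ?thesis
  proof (rule that[OF _ k lim])
    show "p \<in> slopes M" by (rule slopes_pointwise_limit[OF _ lim]) (rule P)
  qed
qed

definition energy :: "(real \<Rightarrow> real) \<Rightarrow> real" where
  "energy p = integral {0..1} (\<lambda>t. (p t)\<^sup>2)"

lemma energy_nonneg: "energy p \<ge> 0"
  unfolding energy_def
  by (cases "(\<lambda>t. (p t)\<^sup>2) integrable_on {0..1}") (auto intro: integral_nonneg simp: not_integrable_integral)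

lemma energy_scale: "energy (\<lambda>t. s * p t) = s\<^sup>2 * energy p"
  by (simp add: energy_def power_mult_distrib)

lemma energy_tendsto:
  assumes P: "\<And>n. P n \<in> slopes M" and lim: "\<And>t. t \<in> {0..1} \<Longrightarrow> (\<lambda>n. P n t) \<longlonglongrightarrow> p t"
  shows "(\<lambda>n. energy (P n)) \<longlonglongrightarrow> energy p"
  unfolding energy_def
proof (rule dominated_convergence(2)[where h = "\<lambda>_. M\<^sup>2"])
  fix n t show "t \<in> {0..1} \<Longrightarrow> norm ((P n t)\<^sup>2) \<le> M\<^sup>2"
    using slopes_bound[OF P, of t n] by (simp add: power2_le_iff_abs_le abs_le_square_iff)
qed (use slopes_continuous_on[OF P] lim in
     \<open>auto intro!: integrable_continuous_interval continuous_intros tendsto_intros\<close>)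

lemma primitive_tendsto:
  assumes P: "\<And>n. P n \<in> slopes M" and lim: "\<And>t. t \<in> {0..1} \<Longrightarrow> (\<lambda>n. P n t) \<longlonglongrightarrow> p t"
    and t: "t \<in> {0..1}"
  shows "(\<lambda>n. primitive (P n) t) \<longlonglongrightarrow> primitive p t"
  unfolding primitive_def
proof (rule dominated_convergence(2)[where h = "\<lambda>_. M"])
  fix n show "P n integrable_on {0..t}"
    using slopes_continuous_on[OF P[of n]] t
    by (auto intro!: integrable_continuous_interval elim: continuous_on_subset)
qed (use slopes_bound[OF P] lim t in auto)

text \<open>
The image of \<open>X\<close> under \<open>E\<close> is a sequentially compact set of reals. The hypotheses ask for pointwise
convergence only, which is all that dominated convergence requires of the functionals below.
\<close>

lemma attains_min_on_slopes:
  fixes E :: "(real \<Rightarrow> real) \<Rightarrow> real"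
  assumes "X \<subseteq> slopes M" "X \<noteq> {}"
    and closed: "\<And>P p. (\<And>n. P n \<in> X) \<Longrightarrow> (\<And>t. t \<in> {0..1} \<Longrightarrow> (\<lambda>n. P n t) \<longlonglongrightarrow> p t) \<Longrightarrow> p \<in> X"
    and cont: "\<And>P p. (\<And>n. P n \<in> slopes M) \<Longrightarrow>
      (\<And>t. t \<in> {0..1} \<Longrightarrow> (\<lambda>n. P n t) \<longlonglongrightarrow> p t) \<Longrightarrow> (\<lambda>n. E (P n)) \<longlonglongrightarrow> E p"
  obtains p where "p \<in> X" "\<And>q. q \<in> X \<Longrightarrow> E p \<le> E q"
proof -
  have "compact (E ` X)"
    unfolding compact_def
  proof (intro allI impI)
    fix e :: "nat \<Rightarrow> real" assume "\<forall>n. e n \<in> E ` X"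
    then have "\<forall>n. \<exists>p. p \<in> X \<and> e n = E p" by blast
    then obtain P where P: "\<And>n. P n \<in> X" "\<And>n. e n = E (P n)" by metis
    then obtain p k where "strict_mono (k :: nat \<Rightarrow> nat)"
      and lim: "\<And>t. t \<in> {0..1} \<Longrightarrow> (\<lambda>n. P (k n) t) \<longlonglongrightarrow> p t"
      using slopes_compact[of P M] assms(1) by (metis subsetD)
    moreover have "p \<in> X" by (rule closed[OF _ lim]) (rule P(1))
    moreover have "(\<lambda>n. E (P (k n))) \<longlonglongrightarrow> E p"
      by (rule cont[OF _ lim]) (use P(1) assms(1) in auto)
    ultimately show "\<exists>l\<in>E ` X. \<exists>r. strict_mono r \<and> (e \<circ> r) \<longlonglongrightarrow> l"
      using P(2) by (auto simp: o_def)
  qed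
  then obtain y where "y \<in> E ` X" "\<forall>z\<in>E ` X. y \<le> z"
    using compact_attains_inf[of "E ` X"] assms(2) by auto
  then show ?thesis using that by auto
qed

section \<open>Concave functions vanishing at both ends\<close>

lemma decreasing_of_derivative_nonpos:
  fixes p :: "real \<Rightarrow> real"
  assumes "\<And>t. t \<in> {0..1} \<Longrightarrow> (p has_real_derivative p' t) (at t within {0..1})"
    and "\<And>t. t \<in> {0..1} \<Longrightarrow> p' t \<le> 0" and "0 \<le> x" "x \<le> y" "y \<le> 1"
  shows "p y \<le> p x"
proof (rule DERIV_nonpos_imp_decreasing_open[OF \<open>x \<le> y\<close>])
  fix z assume "x < z" "z < y"
  then have "(p has_real_derivative p' z) (at z)"
    using assms(1)[of z] assms(3,5) by (simp add: at_within_Icc_at)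
  then show "\<exists>d. (p has_real_derivative d) (at z) \<and> d \<le> 0"
    using assms(2)[of z] assms(3,5) \<open>x < z\<close> \<open>z < y\<close> by auto
next
  have "continuous_on {0..1} p" by (rule DERIV_continuous_on) (rule assms(1))
  then show "continuous_on {x..y} p" using assms by (auto elim: continuous_on_subset)
qed

lemma mvt_within_01:
  fixes u :: "real \<Rightarrow> real"
  assumes "\<And>t. t \<in> {0..1} \<Longrightarrow> (u has_real_derivative u' t) (at t within {0..1})"
    and "0 \<le> x" "x < y" "y \<le> 1"
  obtains z where "x < z" "z < y" "u y - u x = u' z * (y - x)"
proof -
  have "(u has_derivative (*) (u' t)) (at t within {x..y})" if "x \<le> t" "t \<le> y" for t
    using assms(1)[of t] assms(2-4) that unfolding has_field_derivative_def
    by (auto elim: has_derivative_subset)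
  from mvt_simple[OF \<open>x < y\<close> this] show ?thesis using that by auto
qed

text \<open>
If a concave \<open>u\<close> with \<open>u 0 = u 1 = 0\<close> were nonpositive at some \<open>t\<close>, its slope would be
nonpositive somewhere before \<open>t\<close> and nonnegative somewhere after, hence zero in between, and
concavity would leave no room for a positive value.
\<close>

lemma positive_of_decreasing_derivative:
  fixes u :: "real \<Rightarrow> real"
  assumes der: "\<And>t. t \<in> {0..1} \<Longrightarrow> (u has_real_derivative p t) (at t within {0..1})"
    and dec: "\<And>x y. 0 \<le> x \<Longrightarrow> x \<le> y \<Longrightarrow> y \<le> 1 \<Longrightarrow> p y \<le> p x"
    and "u 0 = 0" "u 1 = 0" "t0 \<in> {0..1}" "u t0 > 0" and t: "0 < t" "t < 1"
  shows "u t > 0"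
proof (rule ccontr)
  assume "\<not> u t > 0"
  then have neg: "u t \<le> 0" and ne: "t \<noteq> t0" using \<open>u t0 > 0\<close> by auto
  obtain y where y: "0 < y" "y < t" "u t - u 0 = p y * (t - 0)"
    using mvt_within_01[OF der, of 0 t] t by auto
  obtain z where z: "t < z" "z < 1" "u 1 - u t = p z * (1 - t)"
    using mvt_within_01[OF der, of t 1] t by auto
  have py: "p y \<le> 0" using y neg t \<open>u 0 = 0\<close> by (metis diff_zero mult_le_0_iff not_le)
  have pz: "p z \<ge> 0" using z neg t \<open>u 1 = 0\<close>
    by (metis diff_0 diff_gt_0_iff_gt neg_0_le_iff_le not_le zero_le_mult_iff)
  have zero: "p x = 0" if "y \<le> x" "x \<le> z" for x
    using dec[of y x] dec[of x z] py pz that y z t by linarith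
  \<comment> \<open>the slope vanishes between the two points, so \<open>u t = 0\<close>, and \<open>t0\<close> lies left or right of \<open>t\<close>\<close>
  have ut: "u t = 0" using y zero[of y] z \<open>u 0 = 0\<close> by simp
  show False
  proof (cases "t0 < t")
    case True
    obtain w where w: "t0 < w" "w < t" "u t - u t0 = p w * (t - t0)"
      using mvt_within_01[OF der, of t0 t] t True \<open>t0 \<in> {0..1}\<close> by auto
    have "p w \<ge> 0" using dec[of w t] zero[of t] w y z t \<open>t0 \<in> {0..1}\<close> by auto
    then have "u t - u t0 \<ge> 0" using w True by simp
    then show False using ut \<open>u t0 > 0\<close> by simp
  next
    case False
    with ne have "t < t0" by simp
    obtain w where w: "t < w" "w < t0" "u t0 - u t = p w * (t0 - t)"
      using mvt_within_01[OF der, of t t0] t \<open>t < t0\<close> \<open>t0 \<in> {0..1}\<close> by auto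
    have "p w \<le> 0" using dec[of t w] zero[of t] w y z t \<open>t0 \<in> {0..1}\<close> by auto
    then have "u t0 - u t \<le> 0" using w by (simp add: mult_le_0_iff)
    then show False using ut \<open>u t0 > 0\<close> by simp
  qed
qed

lemma deriv01_eqI:
  "(u has_real_derivative d) (at t within {0..1}) \<Longrightarrow> t \<in> {0..1} \<Longrightarrow> deriv01 u t = d"
  unfolding deriv01_def has_real_derivative_iff_has_vector_derivative
  by (rule vector_derivative_within_closed_interval) auto

lemma has_derivative_deriv01:
  "u differentiable_on {0..1} \<Longrightarrow> t \<in> {0..1} \<Longrightarrow>
    (u has_real_derivative deriv01 u t) (at t within {0..1})"
  unfolding deriv01_def has_real_derivative_iff_has_vector_derivative
  by (simp add: differentiable_on_def vector_derivative_works)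

section \<open>The action functional and its critical points\<close>

locale nonlinear_problem =
  fixes f \<alpha> :: "real \<Rightarrow> real"
  assumes f_cont: "continuous_on {0..} f"
    and f_nonneg: "x \<ge> 0 \<Longrightarrow> f x \<ge> 0"
    and alpha_cont: "continuous_on {0..1} \<alpha>"
    and alpha_pos: "t \<in> {0..1} \<Longrightarrow> \<alpha> t > 0"
    and f_0: "f 0 = 0"
begin

lemma f_extended_cont: "continuous_on S (\<lambda>x. f (max 0 x))"
  by (rule continuous_on_compose2[OF f_cont]) (auto intro!: continuous_intros)

lemma f_extended_nonneg: "f (max 0 x) \<ge> 0"
  by (simp add: f_nonneg)

text \<open>
For \<open>x < 0\<close> the integral over \<open>{0..x}\<close> is one over the empty set, so \<open>primitive f\<close> vanishes
on the negative axis. It is therefore the primitive on the whole line of the extension of \<open>f\<close>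
by zero, which is continuous because \<open>f 0 = 0\<close>. This truncation lets the functionals be defined for
\<open>u\<close> of any sign.
\<close>

lemma primitive_f_derivative: "(primitive f has_real_derivative f (max 0 x)) (at x)"
proof -
  define B where "B = \<bar>x\<bar> + 1"
  define g where "g = (\<lambda>x. f (max 0 x))"
  have B: "B > 0" "-B < x" "x < B" by (auto simp: B_def)
  have gi: "g integrable_on {c..d}" for c d
    unfolding g_def by (intro integrable_continuous_interval f_extended_cont)
  have zero: "integral {-B..y} g = 0" if "y \<le> 0" for y
    by (rule integral_unique, rule has_integral_is_0) (use that in \<open>auto simp: g_def f_0\<close>)
  have eq: "integral {-B..y} g = primitive f y" if "-B < y" for y
  proof (cases "y \<le> 0")
    case False
    have "integral {-B..y} g = integral {-B..0} g + integral {0..y} g"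
      by (rule Henstock_Kurzweil_Integration.integral_combine[symmetric]) (use False B gi in auto)
    also have "integral {0..y} g = integral {0..y} f"
      by (rule integral_cong) (simp add: g_def)
    finally show ?thesis using zero by (simp add: primitive_def)
  qed (simp add: zero primitive_nonpos)
  have "((\<lambda>y. integral {-B..y} g) has_real_derivative g x) (at x within {-B..B})"
    by (rule integral_has_real_derivative) (use B f_extended_cont in \<open>auto simp: g_def\<close>)
  then have "((\<lambda>y. integral {-B..y} g) has_real_derivative g x) (at x)"
    using B by (simp add: at_within_Icc_at)
  then have "(primitive f has_real_derivative g x) (at x)"
    by (rule has_field_derivative_transform_within_open[where S = "{-B<..<B}"]) (use B eq in auto)
  then show ?thesis by (simp add: g_def)
qed

lemma primitive_f_cont: "continuous_on S (primitive f)"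
  by (rule continuous_on_subset[OF DERIV_continuous_on[of UNIV]])
     (use primitive_f_derivative in auto)

lemma primitive_f_mono: "x \<le> y \<Longrightarrow> primitive f x \<le> primitive f y"
  by (erule DERIV_nonneg_imp_nondecreasing) (use primitive_f_derivative f_extended_nonneg in blast)

lemma primitive_f_nonneg: "primitive f x \<ge> 0"
  using primitive_f_mono[of 0 x] primitive_nonpos[of x f] by (cases "x \<le> 0") auto

definition potential :: "(real \<Rightarrow> real) \<Rightarrow> real" where
  "potential p = integral {0..1} (\<lambda>t. \<alpha> t * primitive f (primitive p t))"

lemma potential_pos_imp_positive_value:
  assumes "potential p > 0"
  obtains t where "t \<in> {0..1}" "primitive p t > 0"
proof (rule ccontr)
  assume "\<not> thesis"
  then have "primitive p t \<le> 0" if "t \<in> {0..1}" for t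
    using that \<open>\<And>t. t \<in> {0..1} \<Longrightarrow> primitive p t > 0 \<Longrightarrow> thesis\<close> by force
  then have "potential p = integral {0..1} (\<lambda>t::real. 0)"
    unfolding potential_def by (intro integral_cong) (simp add: primitive_nonpos)
  then show False using assms by simp
qed

lemma potential_integrand_cont:
  "continuous_on {0..1} p \<Longrightarrow> continuous_on {0..1} (\<lambda>t. \<alpha> t * primitive f (primitive p t))"
  by (intro continuous_intros alpha_cont continuous_on_compose2[OF primitive_f_cont]
      primitive_continuous_on) auto

lemma potential_tendsto:
  assumes P: "\<And>n. P n \<in> slopes M" and lim: "\<And>t. t \<in> {0..1} \<Longrightarrow> (\<lambda>n. P n t) \<longlonglongrightarrow> p t"
  shows "(\<lambda>n. potential (P n)) \<longlonglongrightarrow> potential p"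
  unfolding potential_def
proof (rule dominated_convergence(2)[where h = "\<lambda>t. \<alpha> t * primitive f M"])
  show "(\<lambda>t. \<alpha> t * primitive f (primitive (P n) t)) integrable_on {0..1}" for n
    by (intro integrable_continuous_interval potential_integrand_cont slopes_continuous_on[OF P])
  show "(\<lambda>t. \<alpha> t * primitive f M) integrable_on {0..1}"
    by (intro integrable_continuous_interval continuous_intros alpha_cont)
next
  fix n and t :: real assume t: "t \<in> {0..1}"
  have "\<bar>primitive (P n) t\<bar> \<le> M * (t - 0)"
    unfolding primitive_def real_norm_def[symmetric]
    by (rule integral_bound) (use t slopes_bound[OF P] continuous_on_subset[OF slopes_continuous_on[OF P]]
        in auto)
  also have "\<dots> \<le> M * 1"
    using t slopes_bound[OF P t] by (intro mult_left_mono) (auto intro: order_trans[OF abs_ge_zero])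
  finally have "primitive (P n) t \<le> M" by simp
  then show "norm (\<alpha> t * primitive f (primitive (P n) t)) \<le> \<alpha> t * primitive f M"
    using alpha_pos[OF t] primitive_f_nonneg primitive_f_mono by (simp add: abs_mult)
next
  fix t :: real assume t: "t \<in> {0..1}"
  have "isCont (primitive f) (primitive p t)"
    using primitive_f_derivative by (rule DERIV_isCont)
  then show "(\<lambda>n. \<alpha> t * primitive f (primitive (P n) t)) \<longlonglongrightarrow> \<alpha> t * primitive f (primitive p t)"
    by (intro tendsto_intros isCont_tendsto_compose[OF _ primitive_tendsto[OF P lim t]])
qed

definition action :: "real \<Rightarrow> (real \<Rightarrow> real) \<Rightarrow> real" where
  "action lam p = energy p / 2 - lam * potential p"

lemma action_tendsto:
  assumes P: "\<And>n. P n \<in> slopes M" and lim: "\<And>t. t \<in> {0..1} \<Longrightarrow> (\<lambda>n. P n t) \<longlonglongrightarrow> p t"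
  shows "(\<lambda>n. action lam (P n)) \<longlonglongrightarrow> action lam p"
  unfolding action_def by (intro tendsto_intros energy_tendsto[OF P lim] potential_tendsto[OF P lim]) auto

lemma action_as_integral:
  assumes "continuous_on {0..1} p"
  shows "action lam p = integral {0..1} (\<lambda>t. (p t)\<^sup>2 / 2 - lam * (\<alpha> t * primitive f (primitive p t)))"
proof -
  have "(\<lambda>t. (p t)\<^sup>2 / 2) integrable_on {0..1}"
    "(\<lambda>t. lam * (\<alpha> t * primitive f (primitive p t))) integrable_on {0..1}"
    by (intro integrable_continuous_interval continuous_intros potential_integrand_cont assms; simp)+
  then show ?thesis
    by (simp add: action_def energy_def potential_def integral_diff)
qed

text \<open>
This is the heart of the existence proof. Let \<open>q\<close> be the slope of the solution \<open>v\<close> of the linear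
problem \<open>- v'' = lam \<alpha> f(u)\<close>, where \<open>u = primitive p\<close>. In the direction \<open>q - p\<close>, the potential term
of the derivative of the action turns by integration by parts into \<open>\<integral> q (q - p)\<close>, which leaves
\<open>\<integral> p (q - p) - \<integral> q (q - p) = - \<integral> (q - p)\<^sup>2\<close>. So one explicit direction replaces the
Euler--Lagrange equation for all test functions.
\<close>

lemma action_derivative_towards_response:
  assumes p: "continuous_on {0..1} p"
    and q': "\<And>t. t \<in> {0..1} \<Longrightarrow>
      (q has_real_derivative - lam * \<alpha> t * f (max 0 (primitive p t))) (at t within {0..1})"
    and ends: "primitive p 1 = 0" "primitive q 1 = 0"
  shows "((\<lambda>\<epsilon>. action lam (\<lambda>t. (1 - \<epsilon>) * p t + \<epsilon> * q t)) has_real_derivative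
    - integral {0..1} (\<lambda>t. (q t - p t)\<^sup>2)) (at 0)"
proof -
  define d where "d = (\<lambda>t. q t - p t)"
  define u where "u = primitive p"
  define w where "w = primitive d"
  define h where "h = (\<lambda>\<epsilon> t. (p t + \<epsilon> * d t)\<^sup>2 / 2 - lam * (\<alpha> t * primitive f (u t + \<epsilon> * w t)))"
  define h' where "h' = (\<lambda>\<epsilon> t. (p t + \<epsilon> * d t) * d t - lam * (\<alpha> t * (f (max 0 (u t + \<epsilon> * w t)) * w t)))"
  have q: "continuous_on {0..1} q" by (rule DERIV_continuous_on) (rule q')
  have d: "continuous_on {0..1} d" unfolding d_def by (intro continuous_intros p q)
  have u: "continuous_on {0..1} u" unfolding u_def by (intro primitive_continuous_on p)
  have w: "continuous_on {0..1} w" unfolding w_def by (intro primitive_continuous_on d)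
  have w1: "w 1 = 0"
    using primitive_linear_combination[OF q p, of 1 1 "-1"] ends by (simp add: w_def d_def)
  have w0: "w 0 = 0" by (simp add: w_def)
  have act: "action lam (\<lambda>t. (1 - \<epsilon>) * p t + \<epsilon> * q t) = integral {0..1} (h \<epsilon>)" for \<epsilon>
  proof -
    have c: "continuous_on {0..1} (\<lambda>t. (1 - \<epsilon>) * p t + \<epsilon> * q t)"
      by (intro continuous_intros p q)
    have e: "(1 - \<epsilon>) * p t + \<epsilon> * q t = p t + \<epsilon> * d t" for t
      by (simp add: d_def algebra_simps)
    show ?thesis
      unfolding action_as_integral[OF c] unfolding e
      by (rule integral_cong)
         (use primitive_linear_combination[OF p d, of _ 1 \<epsilon>] in \<open>simp add: e h_def u_def w_def\<close>)
  qed
  have "((\<lambda>\<epsilon>. integral (cbox 0 1) (h \<epsilon>)) has_real_derivative integral (cbox 0 1) (h' 0)) (at 0 within UNIV)"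
  proof (rule leibniz_rule_field_derivative)
    fix \<epsilon> t :: real assume "t \<in> cbox 0 1"
    have "((\<lambda>\<epsilon>. primitive f (u t + \<epsilon> * w t)) has_real_derivative f (max 0 (u t + \<epsilon> * w t)) * w t) (at \<epsilon>)"
      by (rule DERIV_chain2[OF primitive_f_derivative]) (auto intro!: derivative_eq_intros)
    then show "((\<lambda>\<epsilon>. h \<epsilon> t) has_real_derivative h' \<epsilon> t) (at \<epsilon> within UNIV)"
      unfolding h_def h'_def by (auto intro!: derivative_eq_intros)
  next
    fix \<epsilon> :: real show "h \<epsilon> integrable_on cbox 0 1"
      unfolding h_def
      by (intro integrable_continuous continuous_intros continuous_on_compose2[OF primitive_f_cont[of UNIV]])
         (use p d u w alpha_cont in auto)
  next
    have s: "continuous_on (UNIV \<times> cbox 0 1) (\<lambda>z :: real \<times> real. g (snd z))"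
      if "continuous_on {0..1} g" for g :: "real \<Rightarrow> real"
      by (rule continuous_on_compose2[OF that]) (auto intro!: continuous_intros)
    show "continuous_on (UNIV \<times> cbox 0 1) (\<lambda>(\<epsilon>, t). h' \<epsilon> t)"
      unfolding h'_def case_prod_beta
      by (intro continuous_intros continuous_on_compose2[OF f_extended_cont[of UNIV]] s p d u w alpha_cont) auto
  qed auto
  moreover have "integral {0..1} (h' 0) = - integral {0..1} (\<lambda>t. (d t)\<^sup>2)"
  proof -
    \<comment> \<open>integration by parts: \<open>q w\<close> vanishes at both ends\<close>
    have "((\<lambda>t. - lam * \<alpha> t * f (max 0 (u t)) * w t + d t * q t) has_integral
        q 1 * w 1 - q 0 * w 0) {0..1}"
    proof (rule fundamental_theorem_of_calculus)
      fix t :: real assume t: "t \<in> {0..1}"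
      have "(w has_real_derivative d t) (at t within {0..1})"
        unfolding w_def by (rule primitive_has_derivative_within[OF d t])
      from DERIV_mult[OF q'[OF t] this]
      show "((\<lambda>t. q t * w t) has_vector_derivative
        - lam * \<alpha> t * f (max 0 (u t)) * w t + d t * q t) (at t within {0..1})"
        unfolding has_real_derivative_iff_has_vector_derivative[symmetric] u_def .
    qed simp
    then have parts: "((\<lambda>t. - lam * \<alpha> t * f (max 0 (u t)) * w t + d t * q t) has_integral 0) {0..1}"
      using w0 w1 by simp
    have "((\<lambda>t. (d t)\<^sup>2) has_integral integral {0..1} (\<lambda>t. (d t)\<^sup>2)) {0..1}"
      by (intro integrable_integral integrable_continuous_interval continuous_intros d)
    from has_integral_diff[OF parts this]
    have "(h' 0 has_integral - integral {0..1} (\<lambda>t. (d t)\<^sup>2)) {0..1}"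
      by (simp add: h'_def d_def power2_eq_square algebra_simps)
    then show ?thesis by (rule integral_unique)
  qed
  ultimately show ?thesis by (simp add: act d_def)
qed

end

context nonlinear_problem begin

text \<open>
The slope \<open>q\<close> of the solution of the linear problem with right-hand side \<open>lam \<alpha> f(u)\<close>. It has \<open>M\<close>
as a Lipschitz constant as soon as \<open>M\<close> bounds this right-hand side, so the direction from \<open>p\<close> to \<open>q\<close>
stays among the admissible slopes.
\<close>

lemma response_exists:
  assumes p: "continuous_on {0..1} p"
    and bound: "\<And>t. t \<in> {0..1} \<Longrightarrow> \<bar>lam * \<alpha> t * f (max 0 (primitive p t))\<bar> \<le> M"
  obtains q where "q \<in> slopes M" "\<And>t. t \<in> {0..1} \<Longrightarrow>
      (q has_real_derivative - lam * \<alpha> t * f (max 0 (primitive p t))) (at t within {0..1})"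
proof -
  define g where "g = (\<lambda>t. - lam * \<alpha> t * f (max 0 (primitive p t)))"
  \<comment> \<open>subtracting the mean of \<open>primitive g\<close> produces the mean-zero primitive\<close>
  define q where "q = (\<lambda>t. primitive g t - primitive (primitive g) 1)"
  have g: "continuous_on {0..1} g" unfolding g_def
    by (intro continuous_intros continuous_on_compose2[OF f_extended_cont[of UNIV]]
        primitive_continuous_on p alpha_cont) auto
  have q': "(q has_real_derivative g t) (at t within {0..1})" if "t \<in> {0..1}" for t
    unfolding q_def using primitive_has_derivative_within[OF g that]
    by (auto intro!: derivative_eq_intros)
  have "M-lipschitz_on {0..1} q"
  proof (rule lipschitz_onI)
    fix x y :: real assume "x \<in> {0..1}" "y \<in> {0..1}"
    then show "dist (q x) (q y) \<le> M * dist x y"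
      unfolding dist_norm
      by (intro field_differentiable_bound[where S = "{0..1}" and f' = g])
         (use q' bound in \<open>auto simp: g_def abs_mult\<close>)
  next
    show "0 \<le> M" using bound[of 0] by (auto intro: order_trans[OF abs_ge_zero])
  qed
  moreover have "primitive q 1 = 0"
  proof -
    have "primitive g integrable_on {0..1}"
      by (intro integrable_continuous_interval primitive_continuous_on g)
    then have "integral {0..1} q = integral {0..1} (primitive g) - primitive (primitive g) 1"
      unfolding q_def by (subst integral_diff) auto
    then show ?thesis by (simp add: primitive_def[of q] primitive_def[of "primitive g"])
  qed
  ultimately have "q \<in> slopes M" by (simp add: slopes_def)
  with q' that show ?thesis unfolding g_def by blast
qed

text \<open>
Otherwise moving from \<open>p\<close> slightly towards \<open>q\<close> decreases the action. The segment consists of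
admissible slopes by convexity, and its initial part satisfies the energy constraint because \<open>p\<close>
satisfies it strictly.
\<close>

lemma interior_minimizer_is_response:
  assumes p: "p \<in> slopes M" and q: "q \<in> slopes M" and interior: "energy p < \<rho>"
    and q': "\<And>t. t \<in> {0..1} \<Longrightarrow>
      (q has_real_derivative - lam * \<alpha> t * f (max 0 (primitive p t))) (at t within {0..1})"
    and min: "\<And>g. g \<in> slopes M \<Longrightarrow> energy g \<le> \<rho> \<Longrightarrow> action lam p \<le> action lam g"
    and t: "t \<in> {0..1}"
  shows "q t = p t"
proof (rule ccontr)
  assume ne: "q t \<noteq> p t"
  define c where "c = (\<lambda>\<epsilon> t. (1 - \<epsilon>) * p t + \<epsilon> * q t)"
  note pc = slopes_continuous_on[OF p] and qc = slopes_continuous_on[OF q]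
  have "integral {0..1} (\<lambda>t. (q t - p t)\<^sup>2) > 0"
    by (rule integral_pos_of_continuous_nonneg[OF _ _ t]) (use ne in \<open>auto intro!: continuous_intros pc qc\<close>)
  then have neg: "- integral {0..1} (\<lambda>t. (q t - p t)\<^sup>2) < 0" by simp
  have "((\<lambda>\<epsilon>. action lam (c \<epsilon>)) has_real_derivative - integral {0..1} (\<lambda>t. (q t - p t)\<^sup>2)) (at 0)"
    unfolding c_def
    by (rule action_derivative_towards_response[OF pc q']) (use p q in \<open>auto simp: slopes_def\<close>)
  from DERIV_neg_dec_right[OF this neg] obtain \<delta> where \<delta>: "\<delta> > 0"
    "\<And>h. h > 0 \<Longrightarrow> h < \<delta> \<Longrightarrow> action lam (c h) < action lam (c 0)" by auto
  \<comment> \<open>a sequence on the segment, so that sequential continuity of the energy applies\<close>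
  define P where "P = (\<lambda>n. c (1 / (real n + 1)))"
  have P: "P n \<in> slopes M" for n
    unfolding P_def c_def by (rule slopes_convex_combination[OF p q]) auto
  have zero: "(\<lambda>n. 1 / (real n + 1)) \<longlonglongrightarrow> 0" by real_asymp
  have lim: "(\<lambda>n. P n s) \<longlonglongrightarrow> p s" for s
    unfolding P_def c_def by (rule tendsto_eq_intros zero refl | simp)+
  have "\<forall>\<^sub>F n in sequentially. energy (P n) < \<rho>"
    by (rule order_tendstoD(2)[OF energy_tendsto[OF P lim] interior])
  moreover have "\<forall>\<^sub>F n in sequentially. 1 / (real n + 1) < \<delta>"
    by (rule order_tendstoD(2)[OF zero \<delta>(1)])
  ultimately obtain n where n: "energy (P n) < \<rho>" "1 / (real n + 1) < \<delta>"
    by (metis (mono_tags, lifting) eventually_conj eventually_happens trivial_limit_sequentially)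
  have "action lam (P n) < action lam (c 0)" unfolding P_def by (rule \<delta>(2)) (use n in auto)
  also have "c 0 = p" by (simp add: c_def)
  finally show False using min[OF P[of n]] n(1) by simp
qed

text \<open>
By \<open>interior_minimizer_is_response\<close> the minimizer satisfies the equation with the truncated
nonlinearity. Then \<open>u\<close> is concave, and it is positive somewhere because its action is negative; hence it
is positive throughout the open interval and the truncation has no effect.
\<close>

lemma interior_minimizer_solves:
  assumes p: "p \<in> slopes M" and interior: "energy p < s\<^sup>2" and s: "0 < s" and lam: "lam > 0"
    and bound: "\<And>t x. t \<in> {0..1} \<Longrightarrow> x \<in> {0..s} \<Longrightarrow> lam * \<alpha> t * f x \<le> M"
    and min: "\<And>g. g \<in> slopes M \<Longrightarrow> energy g \<le> s\<^sup>2 \<Longrightarrow> action lam p \<le> action lam g"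
    and neg: "action lam p < 0"
  shows "bvp_solution \<alpha> f lam (primitive p)"
    and "integral {0..1} (\<lambda>t. \<bar>deriv01 (primitive p) t\<bar>\<^sup>2) = energy p"
proof -
  define u where "u = primitive p"
  define g where "g = (\<lambda>t. - lam * \<alpha> t * f (max 0 (u t)))"
  note pc = slopes_continuous_on[OF p]
  have u': "(u has_real_derivative p t) (at t within {0..1})" if "t \<in> {0..1}" for t
    unfolding u_def by (rule primitive_has_derivative_within[OF pc that])
  have us: "\<bar>u t\<bar> \<le> s" if "t \<in> {0..1}" for t
    unfolding u_def by (rule abs_primitive_le_energy[OF pc _ s that]) (use interior in \<open>simp add: energy_def\<close>)
  have b: "\<bar>lam * \<alpha> t * f (max 0 (primitive p t))\<bar> \<le> M" if "t \<in> {0..1}" for t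
    using bound[OF that, of "max 0 (u t)"] us[OF that] s lam alpha_pos[OF that] f_extended_nonneg[of "u t"]
    by (simp add: u_def[symmetric] abs_mult)
  obtain q where q: "q \<in> slopes M" and q': "\<And>t. t \<in> {0..1} \<Longrightarrow>
      (q has_real_derivative - lam * \<alpha> t * f (max 0 (primitive p t))) (at t within {0..1})"
    using response_exists[OF pc b] by blast
  have qp: "q t = p t" if "t \<in> {0..1}" for t
    by (rule interior_minimizer_is_response[OF p q interior q' min that])
  have p': "(p has_real_derivative g t) (at t within {0..1})" if t: "t \<in> {0..1}" for t
    using q'[OF t] unfolding g_def u_def
    by (rule has_field_derivative_transform_within[where d = 1]) (use t qp in auto)
  have g_nonpos: "g t \<le> 0" if "t \<in> {0..1}" for t
    unfolding g_def using lam alpha_pos[OF that] f_extended_nonneg by (simp add: mult_nonneg_nonneg)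
  have u0: "u 0 = 0" and u1: "u 1 = 0" using p by (auto simp: u_def slopes_def)
  have "lam * potential p > 0" using neg energy_nonneg[of p] by (simp add: action_def)
  then have "potential p > 0" using lam by (simp add: zero_less_mult_iff)
  then obtain t0 where t0: "t0 \<in> {0..1}" "u t0 > 0"
    unfolding u_def by (rule potential_pos_imp_positive_value)
  have pos: "u t > 0" if "0 < t" "t < 1" for t
    by (rule positive_of_decreasing_derivative[OF u' _ u0 u1 t0 that])
       (auto intro: decreasing_of_derivative_nonpos[OF p' g_nonpos])
  have nonneg: "u t \<ge> 0" if "t \<in> {0..1}" for t
    using pos[of t] u0 u1 that by (cases "t = 0 \<or> t = 1") auto
  have d1: "deriv01 u t = p t" if "t \<in> {0..1}" for t
    by (rule deriv01_eqI[OF u'[OF that] that])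
  have d1': "(deriv01 u has_real_derivative g t) (at t within {0..1})" if t: "t \<in> {0..1}" for t
    using p'[OF t] by (rule has_field_derivative_transform_within[where d = 1]) (use t d1 in auto)
  have d2: "deriv01 (deriv01 u) t = g t" if "t \<in> {0..1}" for t
    by (rule deriv01_eqI[OF d1'[OF that] that])
  have "continuous_on {0..1} u" unfolding u_def by (rule primitive_continuous_on[OF pc])
  then have "continuous_on {0..1} g" unfolding g_def
    by (intro continuous_intros continuous_on_compose2[OF f_extended_cont[of UNIV]] alpha_cont) auto
  then have "continuous_on {0..1} (deriv01 (deriv01 u))"
    by (rule continuous_on_eq) (simp add: d2)
  moreover have "u differentiable_on {0..1}" "deriv01 u differentiable_on {0..1}"
    using u' d1' unfolding differentiable_on_def differentiable_def has_field_derivative_def by blast+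
  ultimately have "C2_01 u" by (simp add: C2_01_def)
  then show "bvp_solution \<alpha> f lam (primitive p)"
    unfolding bvp_solution_def using pos u0 u1 d2 nonneg by (auto simp: u_def[symmetric] g_def max_def)
  show "integral {0..1} (\<lambda>t. \<bar>deriv01 (primitive p) t\<bar>\<^sup>2) = energy p"
    unfolding energy_def by (rule integral_cong) (use d1 in \<open>simp add: u_def\<close>)
qed

end

section \<open>Existence of small solutions\<close>

locale sublinear_problem = nonlinear_problem +
  fixes a :: real
  assumes a_pos: "a > 0"
    and ratio_antimono: "antimono_on {0<..a} (\<lambda>\<xi>. primitive f \<xi> / \<xi>\<^sup>2)"
    and ratio_not_constant: "b > 0 \<Longrightarrow> \<not> (\<lambda>\<xi>. primitive f \<xi> / \<xi>\<^sup>2) constant_on {0<..b}"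
begin

text \<open>
The monotonicity of \<open>F(\<xi>)/\<xi>\<^sup>2\<close> in a form that also holds for \<open>x \<le> 0\<close>, where both sides vanish.
\<close>

lemma primitive_f_scale_le:
  assumes "0 \<le> s" "s \<le> 1" "x \<le> a"
  shows "s\<^sup>2 * primitive f x \<le> primitive f (s * x)"
proof (cases "s = 0 \<or> x \<le> 0")
  case True
  then show ?thesis
    using primitive_f_nonneg by (auto simp: primitive_nonpos)
next
  case False
  then have x: "0 < x" "0 < s" using assms by auto
  have "primitive f x / x\<^sup>2 \<le> primitive f (s * x) / (s * x)\<^sup>2"
    by (rule monotone_onD[OF ratio_antimono]) (use x assms in \<open>auto simp: mult_left_le_one_le intro: order_trans[OF mult_left_le_one_le]\<close>)
  then show ?thesis using x by (simp add: field_simps power_mult_distrib)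
qed

lemma ex_scale_strict:
  assumes x: "0 < x" "x \<le> a"
  obtains s where "0 < s" "s \<le> 1" "s\<^sup>2 * primitive f x < primitive f (s * x)"
proof -
  obtain y where y: "0 < y" "y \<le> x" "primitive f y / y\<^sup>2 \<noteq> primitive f x / x\<^sup>2"
    using ratio_not_constant[OF x(1)] unfolding constant_on_def by force
  have "primitive f x / x\<^sup>2 \<le> primitive f y / y\<^sup>2"
    by (rule monotone_onD[OF ratio_antimono]) (use x y in auto)
  then have lt: "primitive f x / x\<^sup>2 < primitive f y / y\<^sup>2" using y(3) by simp
  show ?thesis
  proof (rule that[of "y / x"])
    show "(y / x)\<^sup>2 * primitive f x < primitive f (y / x * x)"
      using lt x y by (simp add: field_simps power_divide)
  qed (use x y in auto)
qed

lemma primitive_f_pos: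
  assumes x: "0 < x"
  shows "primitive f x > 0"
proof -
  obtain s where s: "0 < s" "s \<le> 1" "s\<^sup>2 * primitive f (min x a) < primitive f (s * min x a)"
    using ex_scale_strict[of "min x a"] x a_pos by auto
  have "0 \<le> s\<^sup>2 * primitive f (min x a)" by (simp add: primitive_f_nonneg)
  also note s(3)
  also have "primitive f (s * min x a) \<le> primitive f x"
  proof (rule primitive_f_mono)
    have "s * min x a \<le> 1 * min x a" by (rule mult_right_mono) (use s x a_pos in auto)
    then show "s * min x a \<le> x" by simp
  qed
  finally show ?thesis .
qed

text \<open>
Shrinking \<open>u\<close> improves the ratio of potential to energy strictly: by monotonicity the integrand
does not get worse at any point, and at a point with \<open>u t0 > 0\<close> a suitable factor improves it,
because the ratio is not constant on \<open>{0<..u t0}\<close>.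
\<close>

lemma potential_scale_strict:
  assumes p: "continuous_on {0..1} p" and le: "\<And>t. t \<in> {0..1} \<Longrightarrow> primitive p t \<le> a"
    and pos: "potential p > 0"
  obtains s where "0 < s" "s \<le> 1" "s\<^sup>2 * potential p < potential (\<lambda>t. s * p t)"
proof -
  obtain t0 where t0: "t0 \<in> {0..1}" "primitive p t0 > 0"
    using potential_pos_imp_positive_value[OF pos] .
  obtain s where s: "0 < s" "s \<le> 1"
    "s\<^sup>2 * primitive f (primitive p t0) < primitive f (s * primitive p t0)"
    using ex_scale_strict[OF t0(2) le[OF t0(1)]] .
  have sp: "continuous_on {0..1} (\<lambda>t. s * p t)" by (intro continuous_intros p)
  have prim: "primitive (\<lambda>t. s * p t) t = s * primitive p t" for t
    by (simp add: primitive_def)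
  have int: "(\<lambda>t. \<alpha> t * primitive f (primitive g t)) integrable_on {0..1}"
    if "continuous_on {0..1} g" for g
    by (intro integrable_continuous_interval potential_integrand_cont that)
  have "integral {0..1} (\<lambda>t. \<alpha> t * primitive f (primitive (\<lambda>t. s * p t) t)
    - s\<^sup>2 * (\<alpha> t * primitive f (primitive p t))) > 0"
  proof (rule integral_pos_of_continuous_nonneg[OF _ _ t0(1)])
    show "continuous_on {0..1} (\<lambda>t. \<alpha> t * primitive f (primitive (\<lambda>t. s * p t) t)
        - s\<^sup>2 * (\<alpha> t * primitive f (primitive p t)))"
      by (intro continuous_on_diff continuous_on_mult_left potential_integrand_cont p sp)
  next
    fix t :: real assume t: "t \<in> {0..1}"
    have "s\<^sup>2 * primitive f (primitive p t) \<le> primitive f (s * primitive p t)"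
      using primitive_f_scale_le[of s, OF _ s(2) le[OF t]] s by simp
    from mult_left_mono[OF this, of "\<alpha> t"] show "\<alpha> t * primitive f (primitive (\<lambda>t. s * p t) t)
        - s\<^sup>2 * (\<alpha> t * primitive f (primitive p t)) \<ge> 0"
      using alpha_pos[OF t] by (simp add: prim algebra_simps)
  next
    from mult_strict_left_mono[OF s(3), of "\<alpha> t0"]
    show "\<alpha> t0 * primitive f (primitive (\<lambda>t. s * p t) t0)
        - s\<^sup>2 * (\<alpha> t0 * primitive f (primitive p t0)) > 0"
      using alpha_pos[OF t0(1)] by (simp add: prim algebra_simps)
  qed
  also have "integral {0..1} (\<lambda>t. \<alpha> t * primitive f (primitive (\<lambda>t. s * p t) t)
    - s\<^sup>2 * (\<alpha> t * primitive f (primitive p t))) = potential (\<lambda>t. s * p t) - s\<^sup>2 * potential p"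
    unfolding potential_def
    by (subst integral_diff) (use int[OF p] int[OF sp] integrable_on_mult_right[OF int[OF p]] in auto)
  finally show ?thesis using that s by simp
qed

text \<open>
The slope of a parabola \<open>c t (1 - t)\<close>. It provides a positive lower bound for the maximal potential
on the sphere that does not depend on the Lipschitz bound, which is what allows that bound to be chosen
afterwards.
\<close>

lemma ex_parabola_slope:
  assumes "s > 0"
  obtains p K where "p \<in> slopes K" "energy p = s\<^sup>2" "potential p > 0"
proof -
  \<comment> \<open>the energy of \<open>c t (1 - t)\<close> is \<open>c\<^sup>2 / 3\<close>\<close>
  define c where "c = sqrt 3 * s"
  define p where "p = (\<lambda>t::real. c * (1 - 2 * t))"
  have c: "c > 0" "c\<^sup>2 = 3 * s\<^sup>2" using assms by (auto simp: c_def power_mult_distrib)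
  have pc: "continuous_on S p" for S unfolding p_def by (intro continuous_intros)
  have prim: "primitive p t = c * (t - t\<^sup>2)" if "t \<ge> 0" for t
    unfolding primitive_def
  proof (rule integral_unique)
    have "(p has_integral c * (t - t\<^sup>2) - c * (0 - 0\<^sup>2)) {0..t}"
      by (rule fundamental_theorem_of_calculus)
         (use that in \<open>auto simp: p_def has_real_derivative_iff_has_vector_derivative[symmetric]
            intro!: derivative_eq_intros\<close>)
    then show "(p has_integral c * (t - t\<^sup>2)) {0..t}" by simp
  qed
  have lip: "(2 * c)-lipschitz_on {0..1} p"
  proof (rule lipschitz_onI)
    fix x y :: real
    have "p x - p y = 2 * c * (y - x)" by (simp add: p_def algebra_simps)
    then show "dist (p x) (p y) \<le> 2 * c * dist x y"
      using c by (simp add: dist_real_def abs_mult abs_minus_commute)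
  qed (use c in auto)
  have en: "energy p = s\<^sup>2"
    unfolding energy_def
  proof (rule integral_unique)
    have "((\<lambda>t. (p t)\<^sup>2) has_integral (- c\<^sup>2 * (1 - 2 * 1) ^ 3 / 6) - (- c\<^sup>2 * (1 - 2 * 0) ^ 3 / 6)) {0..1}"
      by (rule fundamental_theorem_of_calculus)
         (auto simp: p_def has_real_derivative_iff_has_vector_derivative[symmetric] power_mult_distrib
            intro!: derivative_eq_intros)
    then show "((\<lambda>t. (p t)\<^sup>2) has_integral s\<^sup>2) {0..1}" using c by simp
  qed
  have "potential p > 0"
    unfolding potential_def
  proof (rule integral_pos_of_continuous_nonneg[of _ "1/2"])
    show "\<alpha> (1/2) * primitive f (primitive p (1/2)) > 0"
      using c alpha_pos[of "1/2"] by (intro mult_pos_pos primitive_f_pos) (auto simp: prim power2_eq_square)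
    show "\<alpha> t * primitive f (primitive p t) \<ge> 0" if "t \<in> {0..1}" for t
      using alpha_pos[OF that] primitive_f_nonneg by simp
  qed (use potential_integrand_cont[OF pc] in auto)
  moreover have "p \<in> slopes (2 * c)" using lip prim[of 1] by (simp add: slopes_def)
  ultimately show ?thesis using that en by blast
qed

text \<open>
With \<open>p1\<close> of largest potential on the sphere \<open>energy p = s\<^sup>2\<close>, the action is positive on the sphere as
long as \<open>lam < s\<^sup>2 / (2 potential p1)\<close>. A shrunk copy of \<open>p1\<close> has a larger quotient \<open>J2\<close> of potential
by squared factor, so its action is negative as soon as \<open>lam > s\<^sup>2 / (2 J2)\<close>, which is a smaller
number. Between the two thresholds the minimum over the ball is attained in the interior.
\<close>

lemma small_solutions_exist:
  assumes r: "r > 0"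
  shows "\<exists>I. open_interval I \<and> I \<subseteq> {0<..} \<and> (\<forall>lam\<in>I. \<exists>u. bvp_solution \<alpha> f lam u \<and>
    integral {0..1} (\<lambda>t. \<bar>deriv01 u t\<bar>\<^sup>2) < r)"
proof -
  define s where "s = min a (sqrt r)"
  have s: "s > 0" "s \<le> a" "s \<le> sqrt r" using r a_pos by (auto simp: s_def)
  have sr: "s\<^sup>2 \<le> r" using power_mono[OF s(3), of 2] s r by simp
  obtain p0 K where p0: "p0 \<in> slopes K" "energy p0 = s\<^sup>2" "potential p0 > 0"
    using ex_parabola_slope[OF s(1)] .
  have "compact ((\<lambda>z. \<alpha> (fst z) * f (snd z)) ` ({0..1} \<times> {0..s}))"
    by (intro compact_continuous_image compact_Times compact_Icc continuous_intros
        continuous_on_compose2[OF alpha_cont] continuous_on_compose2[OF f_cont]) auto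
  then obtain C where C: "C > 0" "\<And>z. z \<in> {0..1} \<times> {0..s} \<Longrightarrow> norm (\<alpha> (fst z) * f (snd z)) \<le> C"
    using bounded_pos[of "(\<lambda>z. \<alpha> (fst z) * f (snd z)) ` ({0..1} \<times> {0..s})"] compact_imp_bounded by auto
  \<comment> \<open>the second term bounds \<open>lam \<alpha> f\<close> for every parameter in the interval found below\<close>
  define M where "M = max K (C * s\<^sup>2 / (2 * potential p0))"
  have p0M: "p0 \<in> slopes M" using slopes_mono[OF p0(1)] by (simp add: M_def)
  have small: "primitive p t \<le> s" if "p \<in> slopes M" "energy p \<le> s\<^sup>2" "t \<in> {0..1}" for p t
    using abs_primitive_le_energy[OF slopes_continuous_on[OF that(1)] _ s(1) that(3)] that(2)
    by (simp add: energy_def)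
  define sphere where "sphere = {p \<in> slopes M. energy p = s\<^sup>2}"
  define ball where "ball = {p \<in> slopes M. energy p \<le> s\<^sup>2}"
  have sphere_closed: "p \<in> sphere"
    if P: "\<And>n. P n \<in> sphere" and lim: "\<And>t. t \<in> {0..1} \<Longrightarrow> (\<lambda>n. P n t) \<longlonglongrightarrow> p t" for P p
  proof -
    have PM: "P n \<in> slopes M" "energy (P n) = s\<^sup>2" for n using P by (auto simp: sphere_def)
    have "(\<lambda>n. energy (P n)) \<longlonglongrightarrow> energy p" by (rule energy_tendsto[OF PM(1) lim])
    then have "energy p = s\<^sup>2" using PM(2) by (simp add: LIMSEQ_const_iff)
    then show ?thesis using slopes_pointwise_limit[OF PM(1) lim] by (simp add: sphere_def)
  qed
  have ball_closed: "p \<in> ball"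
    if P: "\<And>n. P n \<in> ball" and lim: "\<And>t. t \<in> {0..1} \<Longrightarrow> (\<lambda>n. P n t) \<longlonglongrightarrow> p t" for P p
  proof -
    have PM: "P n \<in> slopes M" "energy (P n) \<le> s\<^sup>2" for n using P by (auto simp: ball_def)
    have "(\<lambda>n. energy (P n)) \<longlonglongrightarrow> energy p" by (rule energy_tendsto[OF PM(1) lim])
    then have "energy p \<le> s\<^sup>2" by (rule Lim_bounded) (use PM(2) in auto)
    then show ?thesis using slopes_pointwise_limit[OF PM(1) lim] by (simp add: ball_def)
  qed
  obtain p1 where p1: "p1 \<in> sphere" "\<And>q. q \<in> sphere \<Longrightarrow> potential q \<le> potential p1"
  proof (rule attains_min_on_slopes[of sphere M "\<lambda>p. - potential p"])
    show "sphere \<subseteq> slopes M" "sphere \<noteq> {}" using p0M p0 by (auto simp: sphere_def)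
    show "(\<lambda>n. - potential (P n)) \<longlonglongrightarrow> - potential p"
      if "\<And>n. P n \<in> slopes M" "\<And>t. t \<in> {0..1} \<Longrightarrow> (\<lambda>n. P n t) \<longlonglongrightarrow> p t" for P p
      by (rule tendsto_minus[OF potential_tendsto[OF that]])
    show "p \<in> sphere" if "\<And>n. P n \<in> sphere" "\<And>t. t \<in> {0..1} \<Longrightarrow> (\<lambda>n. P n t) \<longlonglongrightarrow> p t" for P p
      by (rule sphere_closed[OF that])
  qed auto
  have p1M: "p1 \<in> slopes M" "energy p1 = s\<^sup>2" using p1(1) by (auto simp: sphere_def)
  have J1: "potential p0 \<le> potential p1" using p1(2)[of p0] p0M p0(2) by (simp add: sphere_def)
  have J1pos: "potential p1 > 0" using J1 p0(3) by simp
  obtain \<sigma> where \<sigma>: "0 < \<sigma>" "\<sigma> \<le> 1" "\<sigma>\<^sup>2 * potential p1 < potential (\<lambda>t. \<sigma> * p1 t)"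
  proof (rule potential_scale_strict[OF slopes_continuous_on[OF p1M(1)] _ J1pos])
    fix t :: real assume "t \<in> {0..1}"
    then show "primitive p1 t \<le> a" using small[OF p1M(1)] p1M(2) s(2) by force
  qed
  define J2 where "J2 = potential (\<lambda>t. \<sigma> * p1 t) / \<sigma>\<^sup>2"
  have J2: "potential p1 < J2" using \<sigma> by (simp add: J2_def field_simps)
  define I where "I = {s\<^sup>2 / (2 * J2) <..< s\<^sup>2 / (2 * potential p1)}"
  have "s\<^sup>2 / (2 * J2) < s\<^sup>2 / (2 * potential p1)"
    using J2 J1pos s by (intro divide_strict_left_mono) auto
  then have "open_interval I" by (simp add: open_interval_def I_def is_interval_oo)
  moreover have I_pos: "lam > 0" if "lam \<in> I" for lam
  proof -
    have "0 \<le> s\<^sup>2 / (2 * J2)" using J2 J1pos by simp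
    then show ?thesis using that unfolding I_def by (simp del: zero_le_divide_iff)
  qed
  moreover have "\<exists>u. bvp_solution \<alpha> f lam u \<and> integral {0..1} (\<lambda>t. \<bar>deriv01 u t\<bar>\<^sup>2) < r"
    if lam: "lam \<in> I" for lam
  proof -
    have lp: "lam > 0" by (rule I_pos[OF lam])
    have up: "lam * potential p1 < s\<^sup>2 / 2" and lo: "s\<^sup>2 / 2 < lam * J2"
      using lam J1pos J2 by (auto simp: I_def field_simps)
    obtain p where p: "p \<in> ball" "\<And>q. q \<in> ball \<Longrightarrow> action lam p \<le> action lam q"
    proof (rule attains_min_on_slopes[of ball M "action lam"])
      show "ball \<subseteq> slopes M" "ball \<noteq> {}" using p0M p0 by (auto simp: ball_def)
      show "(\<lambda>n. action lam (P n)) \<longlonglongrightarrow> action lam p"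
        if "\<And>n. P n \<in> slopes M" "\<And>t. t \<in> {0..1} \<Longrightarrow> (\<lambda>n. P n t) \<longlonglongrightarrow> p t" for P p
        by (rule action_tendsto[OF that])
      show "p \<in> ball" if "\<And>n. P n \<in> ball" "\<And>t. t \<in> {0..1} \<Longrightarrow> (\<lambda>n. P n t) \<longlonglongrightarrow> p t" for P p
      by (rule ball_closed[OF that])
  qed auto
    have "(\<lambda>t. \<sigma> * p1 t) \<in> ball"
      using slopes_scale[OF p1M(1), of \<sigma>] \<sigma> p1M(2)
      by (simp add: ball_def energy_scale mult_left_le_one_le power_le_one)
    then have "action lam p \<le> action lam (\<lambda>t. \<sigma> * p1 t)" by (rule p(2))
    also have "\<dots> = \<sigma>\<^sup>2 * (s\<^sup>2 / 2 - lam * J2)"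
      using \<sigma> by (simp add: action_def energy_scale p1M J2_def field_simps)
    also have "\<dots> < 0" using lo \<sigma> by (simp add: mult_less_0_iff)
    finally have neg: "action lam p < 0" .
    have "action lam q > 0" if "q \<in> sphere" for q
    proof -
      have "lam * potential q \<le> lam * potential p1" using p1(2)[OF that] lp by simp
      then show ?thesis using up that by (simp add: action_def sphere_def)
    qed
    then have "p \<notin> sphere" using neg by force
    then have interior: "energy p < s\<^sup>2" and pM: "p \<in> slopes M"
      using p(1) by (auto simp: ball_def sphere_def)
    have bound: "lam * \<alpha> t * f x \<le> M" if "t \<in> {0..1}" "x \<in> {0..s}" for t x
    proof -
      have "lam * (\<alpha> t * f x) \<le> lam * C" using C(2)[of "(t, x)"] that lp by (intro mult_left_mono) auto
      also have "\<dots> \<le> s\<^sup>2 / (2 * potential p0) * C"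
      proof (rule mult_right_mono)
        have "lam * potential p0 \<le> lam * potential p1" using J1 lp by simp
        also note up
        finally show "lam \<le> s\<^sup>2 / (2 * potential p0)" using p0(3) by (simp add: field_simps)
      qed (use C in simp)
      also have "\<dots> \<le> M" by (simp add: M_def mult.commute)
      finally show ?thesis by (simp add: mult.assoc)
    qed
    note sol = interior_minimizer_solves[OF pM interior s(1) lp bound _ neg]
    have min: "action lam p \<le> action lam g" if "g \<in> slopes M" "energy g \<le> s\<^sup>2" for g
      using p(2) that by (simp add: ball_def)
    show ?thesis
      using sol(1)[OF _ _ min] sol(2)[OF _ _ min] interior sr by (intro exI[of _ "primitive p"]) auto
  qed
  ultimately show ?thesis by blast
qed

end

section \<open>Nonlinearities that are linear near zero\<close>

lemma bvp_solution_abs_le: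
  assumes u: "bvp_solution \<alpha> f lam u"
    and le: "integral {0..1} (\<lambda>t. \<bar>deriv01 u t\<bar>\<^sup>2) \<le> s\<^sup>2" and s: "s > 0" and t: "t \<in> {0..1}"
  shows "\<bar>u t\<bar> \<le> s"
proof -
  have d: "u differentiable_on {0..1}" "deriv01 u differentiable_on {0..1}" and u0: "u 0 = 0"
    using u by (auto simp: bvp_solution_def C2_01_def)
  have "(deriv01 u has_integral u t - u 0) {0..t}"
  proof (rule fundamental_theorem_of_calculus)
    fix x assume "x \<in> {0..t}"
    then show "(u has_vector_derivative deriv01 u x) (at x within {0..t})"
      using has_derivative_deriv01[OF d(1), of x] t
      unfolding has_real_derivative_iff_has_vector_derivative
      by (auto elim: has_vector_derivative_within_subset)
  qed (use t in simp)
  then have "u t = primitive (deriv01 u) t"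
    unfolding primitive_def using u0 by (simp add: integral_unique)
  then show ?thesis
    using abs_primitive_le_energy[OF differentiable_imp_continuous_on[OF d(2)] _ s t] le by simp
qed

context nonlinear_problem begin

lemma linear_of_constant_ratio:
  assumes b: "b > 0" and const: "(\<lambda>\<xi>. primitive f \<xi> / \<xi>\<^sup>2) constant_on {0<..b}"
  obtains c where "\<And>x. 0 \<le> x \<Longrightarrow> x < b \<Longrightarrow> f x = c * x"
proof -
  obtain c where c: "\<And>x. x \<in> {0<..b} \<Longrightarrow> primitive f x / x\<^sup>2 = c"
    using const unfolding constant_on_def by blast
  show ?thesis
  proof (rule that[of "2 * c"])
    fix x assume x: "0 \<le> x" "x < b"
    show "f x = 2 * c * x"
    proof (cases "x = 0")
      case False
      have "((\<lambda>x. c * x\<^sup>2) has_real_derivative 2 * c * x) (at x)"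
        by (auto intro!: derivative_eq_intros)
      then have "(primitive f has_real_derivative 2 * c * x) (at x)"
        by (rule has_field_derivative_transform_within_open[where S = "{0<..<b}"])
           (use x False c in \<open>auto simp: field_simps\<close>)
      from DERIV_unique[OF this primitive_f_derivative] show ?thesis using x by simp
    qed (simp add: f_0)
  qed
qed

text \<open>
The Wronskian \<open>W\<close> of the two solutions vanishes at both ends, so its derivative
\<open>(lam - mu) c \<alpha> u v\<close> vanishes at an interior point. As \<open>\<alpha>\<close>, \<open>u\<close> and \<open>v\<close> are positive there, different
parameters leave only \<open>c = 0\<close>, and then there is no positive solution at all. In other words, a linear
problem has positive solutions only at its principal eigenvalue.
\<close>

lemma linear_solutions_same_parameter:
  assumes lin: "\<And>x. x \<in> {0..s} \<Longrightarrow> f x = c * x"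
    and u: "bvp_solution \<alpha> f lam u" "\<And>t. t \<in> {0..1} \<Longrightarrow> u t \<le> s"
    and v: "bvp_solution \<alpha> f mu v" "\<And>t. t \<in> {0..1} \<Longrightarrow> v t \<le> s"
  shows "lam = mu"
proof (rule ccontr)
  assume ne: "lam \<noteq> mu"
  have ode: "(w has_real_derivative deriv01 w t) (at t within {0..1})"
    "(deriv01 w has_real_derivative - l * \<alpha> t * (c * w t)) (at t within {0..1})"
    if w: "bvp_solution \<alpha> f l w" "\<And>t. t \<in> {0..1} \<Longrightarrow> w t \<le> s" and t: "t \<in> {0..1}" for w l t
  proof -
    have d: "w differentiable_on {0..1}" "deriv01 w differentiable_on {0..1}"
      using w by (auto simp: bvp_solution_def C2_01_def)
    show "(w has_real_derivative deriv01 w t) (at t within {0..1})"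
      by (rule has_derivative_deriv01[OF d(1) t])
    have "0 \<le> w t"
      using w(1) t unfolding bvp_solution_def by (cases "t = 0 \<or> t = 1") (auto intro: less_imp_le)
    then have "f (w t) = c * w t" using lin[of "w t"] w(2)[OF t] by simp
    moreover have "- deriv01 (deriv01 w) t = l * \<alpha> t * f (w t)"
      using w(1) t unfolding bvp_solution_def by blast
    ultimately have "deriv01 (deriv01 w) t = - l * \<alpha> t * (c * w t)" by simp
    then show "(deriv01 w has_real_derivative - l * \<alpha> t * (c * w t)) (at t within {0..1})"
      using has_derivative_deriv01[OF d(2) t] by simp
  qed
  have ends: "u 0 = 0" "u 1 = 0" "v 0 = 0" "v 1 = 0"
    and pos: "\<And>t. 0 < t \<Longrightarrow> t < 1 \<Longrightarrow> u t > 0 \<and> v t > 0"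
    using u v by (auto simp: bvp_solution_def)
  define W where "W = (\<lambda>t. u t * deriv01 v t - deriv01 u t * v t)"
  have W': "(W has_real_derivative (lam - mu) * c * \<alpha> t * u t * v t) (at t within {0..1})"
    if t: "t \<in> {0..1}" for t
    unfolding W_def using ode[OF u t] ode[OF v t]
    by (auto intro!: derivative_eq_intros simp: algebra_simps)
  obtain z where z: "0 < z" "z < 1" "W 1 - W 0 = (lam - mu) * c * \<alpha> z * u z * v z * (1 - 0)"
    using mvt_within_01[OF W', of 0 1] by auto
  have "c = 0"
    using z ne pos[of z] alpha_pos[of z] by (auto simp: W_def ends)
  \<comment> \<open>hence \<open>u\<close> is affine, and its two zeros make it vanish\<close>
  then have u'': "(deriv01 u has_real_derivative 0) (at t within {0..1})" if "t \<in> {0..1}" for t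
    using ode(2)[OF u that] by simp
  obtain x where x: "0 < x" "x < 1/2" "u (1/2) - u 0 = deriv01 u x * (1/2 - 0)"
    using mvt_within_01[OF ode(1)[OF u], of 0 "1/2"] by auto
  obtain y where y: "1/2 < y" "y < 1" "u 1 - u (1/2) = deriv01 u y * (1 - 1/2)"
    using mvt_within_01[OF ode(1)[OF u], of "1/2" 1] by auto
  have "deriv01 u y - deriv01 u x = 0"
    by (rule mvt_within_01[OF u'', of x y]) (use x y in auto)
  then have "u (1/2) = 0" using x y ends by simp
  then show False using pos[of "1/2"] by simp
qed

text \<open>
If the ratio were constant near zero, the solutions of small energy would solve a linear problem, which
pins down the parameter, whereas an open interval contains two different ones.
\<close>

lemma ratio_not_constant_of_small_solutions:
  assumes small: "\<And>r. r > 0 \<Longrightarrow> \<exists>I. open_interval I \<and> I \<subseteq> {0<..} \<and>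
      (\<forall>lam\<in>I. \<exists>u. bvp_solution \<alpha> f lam u \<and> integral {0..1} (\<lambda>t. \<bar>deriv01 u t\<bar>\<^sup>2) < r)"
    and b: "b > 0"
  shows "\<not> (\<lambda>\<xi>. primitive f \<xi> / \<xi>\<^sup>2) constant_on {0<..b}"
proof
  assume "(\<lambda>\<xi>. primitive f \<xi> / \<xi>\<^sup>2) constant_on {0<..b}"
  then obtain c where c: "\<And>x. 0 \<le> x \<Longrightarrow> x < b \<Longrightarrow> f x = c * x"
    using linear_of_constant_ratio[OF b] by blast
  obtain I where I: "open_interval I" "\<And>lam. lam \<in> I \<Longrightarrow> \<exists>u. bvp_solution \<alpha> f lam u \<and>
      integral {0..1} (\<lambda>t. \<bar>deriv01 u t\<bar>\<^sup>2) < (b / 2)\<^sup>2"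
    using small[of "(b / 2)\<^sup>2"] b by auto
  obtain lam where lam: "lam \<in> I" using I(1) by (auto simp: open_interval_def)
  obtain e where e: "e > 0" "ball lam e \<subseteq> I"
    using I(1) lam by (auto simp: open_interval_def open_contains_ball)
  then have mu: "lam + e / 2 \<in> I" by (auto simp: dist_real_def)
  obtain u where u: "bvp_solution \<alpha> f lam u" "integral {0..1} (\<lambda>t. \<bar>deriv01 u t\<bar>\<^sup>2) < (b / 2)\<^sup>2"
    using I(2)[OF lam] by blast
  obtain v where v: "bvp_solution \<alpha> f (lam + e / 2) v" "integral {0..1} (\<lambda>t. \<bar>deriv01 v t\<bar>\<^sup>2) < (b / 2)\<^sup>2"
    using I(2)[OF mu] by blast
  have bd: "w t \<le> b / 2" if "bvp_solution \<alpha> f l w" "integral {0..1} (\<lambda>t. \<bar>deriv01 w t\<bar>\<^sup>2) < (b / 2)\<^sup>2"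
    "t \<in> {0..1}" for l w t
    using bvp_solution_abs_le[OF that(1) less_imp_le[OF that(2)] _ that(3)] b by simp
  have "lam = lam + e / 2"
    by (rule linear_solutions_same_parameter[of "b / 2" c, OF _ u(1) bd[OF u] v(1) bd[OF v]])
       (use c b in auto)
  with e show False by simp
qed

end

theorem theorem1:
  fixes f \<alpha> :: "real \<Rightarrow> real" and a :: real
  assumes "continuous_on {0..} f"
    and "\<forall>\<xi>\<in>{0..}. f \<xi> \<ge> 0"
    and "continuous_on {0..1} \<alpha>"
    and "\<forall>t\<in>{0..1}. \<alpha> t > 0"
    and "f 0 = 0"
    and "a > 0"
    and "antimono_on {0<..a} (\<lambda>\<xi>. primitive f \<xi> / \<xi>\<^sup>2)"
  shows "(\<forall>b>0. \<not> (\<lambda>\<xi>. primitive f \<xi> / \<xi>\<^sup>2) constant_on {0<..b}) \<longleftrightarrow>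
         (\<forall>r>0. \<exists>I. open_interval I \<and> I \<subseteq> {0<..} \<and>
            (\<forall>lam\<in>I. \<exists>u. bvp_solution \<alpha> f lam u \<and>
               integral {0..1} (\<lambda>t. \<bar>deriv01 u t\<bar>\<^sup>2) < r))"
proof -
  interpret nonlinear_problem f \<alpha>
    by unfold_locales (use assms in auto)
  show ?thesis
  proof (intro iffI allI impI)
    fix r :: real
    assume nc: "\<forall>b>0. \<not> (\<lambda>\<xi>. primitive f \<xi> / \<xi>\<^sup>2) constant_on {0<..b}" and "r > 0"
    interpret sublinear_problem f \<alpha> a
      by unfold_locales (use assms nc in auto)
    show "\<exists>I. open_interval I \<and> I \<subseteq> {0<..} \<and>
        (\<forall>lam\<in>I. \<exists>u. bvp_solution \<alpha> f lam u \<and> integral {0..1} (\<lambda>t. \<bar>deriv01 u t\<bar>\<^sup>2) < r)"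
      by (rule small_solutions_exist[OF \<open>r > 0\<close>])
  qed (rule ratio_not_constant_of_small_solutions, auto)
qed

end
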